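(* Let $D_\lambda$ be a sectorial (diagonal) operator in $\ell^2(J)$ and let $f\in\ell^2(J)$. Let $g:J\to\mathbb C$ be such that for some $z_0\in\rho(D_\lambda)$, $$\sum_{j\in J}\frac{|g(j)|^2}{|\lambda_j-z_0|^2}<\infty.$$ Then $D_\lambda+f\oslash g$ defines a sectorial operator in $\ell^2(J)$ with domain $\mathscr D(D_\lambda)$.
   Context: $J$ is a countably infinite directed set and $\{e_j:j\in J\}$ is the standard orthonormal basis of $\ell^2(J)$. $D_\lambda$ is the (maximally defined) diagonal operator in $\ell^2(J)$ with diagonal entries $\lambda=\{\lambda_j:j\in J\}\subseteq\mathbb C$, $D_\lambda e_j=\lambda_je_j$. The operator $f\oslash g$ has domain $\{h\in\ell^2(J):\sum_{j\in J}h(j)\overline{g(j)}\text{ is convergent}\}$ and $(f\oslash g)h=\big(\sum_{j\in J}h(j)\overline{g(j)}\big)f$. $\rho(T)$ is the resolvent set of $T$. A densely defined operator $T$ is sectorial if there exist $a\in\mathbb R$, $M\in(0,\infty)$ and $\theta\in(0,\pi/2)$ such that $\lambda\in\rho(T)$ and $\|(T-\lambda)^{-1}\|\le\frac{M}{|\lambda-a|}$ whenever $\lambda\in\mathbb C$ and $|\arg(\lambda-a)|\ge\theta$. *)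

theory Defs
  imports "HOL-Analysis.Analysis"
begin

subsection \<open>The space \<open>\<ell>\<^sup>2(J)\<close>\<close>

text \<open>The index set \<open>J\<close> is the universe of a type \<open>'j\<close>.\<close>

definition square_summable :: "('j \<Rightarrow> complex) \<Rightarrow> bool" where
  "square_summable h \<longleftrightarrow> (\<lambda>j. (cmod (h j))\<^sup>2) summable_on UNIV"

lemma L2_set_le_sqrt_infsum:
  assumes "square_summable h" "finite F"
  shows "L2_set (\<lambda>j. cmod (h j)) F \<le> sqrt (\<Sum>\<^sub>\<infinity>j. (cmod (h j))\<^sup>2)"
  unfolding L2_set_def real_sqrt_le_iff
  using assms by (intro finite_sum_le_infsum) (auto simp: square_summable_def)

lemma square_summable_bound:
  assumes "0 \<le> b" and le: "\<And>F. finite F \<Longrightarrow> L2_set (\<lambda>j. cmod (h j)) F \<le> b"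
  shows "square_summable h" "sqrt (\<Sum>\<^sub>\<infinity>j. (cmod (h j))\<^sup>2) \<le> b"
proof -
  have *: "(\<Sum>j\<in>F. (cmod (h j))\<^sup>2) \<le> b\<^sup>2" if "finite F" for F
    using le[OF that] unfolding L2_set_def by (rule sqrt_le_D)
  show "square_summable h"
    unfolding square_summable_def
    by (rule nonneg_bdd_above_summable_on) (auto intro!: bdd_aboveI2[where M = "b\<^sup>2"] *)
  then have "(\<Sum>\<^sub>\<infinity>j. (cmod (h j))\<^sup>2) \<le> b\<^sup>2"
    unfolding square_summable_def by (rule infsum_le_finite_sums) (use * in auto)
  then show "sqrt (\<Sum>\<^sub>\<infinity>j. (cmod (h j))\<^sup>2) \<le> b"
    using \<open>0 \<le> b\<close> by (rule real_le_lsqrt[rotated])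
qed

lemma square_summable_add:
  assumes h: "square_summable h" and k: "square_summable k"
  shows "square_summable (\<lambda>j. h j + k j)"
    and "sqrt (\<Sum>\<^sub>\<infinity>j. (cmod (h j + k j))\<^sup>2)
           \<le> sqrt (\<Sum>\<^sub>\<infinity>j. (cmod (h j))\<^sup>2) + sqrt (\<Sum>\<^sub>\<infinity>j. (cmod (k j))\<^sup>2)"
proof -
  let ?b = "sqrt (\<Sum>\<^sub>\<infinity>j. (cmod (h j))\<^sup>2) + sqrt (\<Sum>\<^sub>\<infinity>j. (cmod (k j))\<^sup>2)"
  have b: "0 \<le> ?b"
    by (intro add_nonneg_nonneg real_sqrt_ge_zero infsum_nonneg) auto
  have le: "L2_set (\<lambda>j. cmod (h j + k j)) F \<le> ?b" if "finite F" for F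
  proof -
    have "L2_set (\<lambda>j. cmod (h j + k j)) F \<le> L2_set (\<lambda>j. cmod (h j) + cmod (k j)) F"
      by (rule L2_set_mono) (auto intro: norm_triangle_ineq)
    also have "\<dots> \<le> L2_set (\<lambda>j. cmod (h j)) F + L2_set (\<lambda>j. cmod (k j)) F"
      by (rule L2_set_triangle_ineq)
    also have "\<dots> \<le> ?b"
      using h k that by (intro add_mono L2_set_le_sqrt_infsum)
    finally show ?thesis .
  qed
  from square_summable_bound[OF b le]
  show "square_summable (\<lambda>j. h j + k j)"
    and "sqrt (\<Sum>\<^sub>\<infinity>j. (cmod (h j + k j))\<^sup>2) \<le> ?b" by auto
qed

lemma square_summable_cmult:
  "square_summable h \<Longrightarrow> square_summable (\<lambda>j. c * h j)"
  by (auto simp: square_summable_def norm_mult power_mult_distrib intro: summable_on_cmult_right)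

typedef 'j ell2 = "{h :: 'j \<Rightarrow> complex. square_summable h}"
  morphisms coord Abs_ell2
  by (rule exI[of _ "\<lambda>_. 0"]) (simp add: square_summable_def)

setup_lifting type_definition_ell2

lemma square_summable_coord [simp]: "square_summable (coord h)"
  using coord by auto

lift_definition cscale :: "complex \<Rightarrow> 'j ell2 \<Rightarrow> 'j ell2" (infixr \<open>*\<^sub>C\<close> 75)
  is "\<lambda>c h j. c * h j"
  by (rule square_summable_cmult)

instantiation ell2 :: (type) real_normed_vector
begin

lift_definition zero_ell2 :: "'j ell2" is "\<lambda>_. 0"
  by (simp add: square_summable_def)

lift_definition plus_ell2 :: "'j ell2 \<Rightarrow> 'j ell2 \<Rightarrow> 'j ell2" is "\<lambda>h k j. h j + k j"
  by (rule square_summable_add)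

lift_definition uminus_ell2 :: "'j ell2 \<Rightarrow> 'j ell2" is "\<lambda>h j. - h j"
  by (simp add: square_summable_def)

definition minus_ell2 :: "'j ell2 \<Rightarrow> 'j ell2 \<Rightarrow> 'j ell2" where
  "minus_ell2 h k = h + - k"

definition scaleR_ell2 :: "real \<Rightarrow> 'j ell2 \<Rightarrow> 'j ell2" where
  "scaleR_ell2 r h = of_real r *\<^sub>C h"

definition norm_ell2 :: "'j ell2 \<Rightarrow> real" where
  "norm_ell2 h = sqrt (\<Sum>\<^sub>\<infinity>j. (cmod (coord h j))\<^sup>2)"

definition dist_ell2 :: "'j ell2 \<Rightarrow> 'j ell2 \<Rightarrow> real" where
  "dist_ell2 h k = norm (h - k)"

definition sgn_ell2 :: "'j ell2 \<Rightarrow> 'j ell2" where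
  "sgn_ell2 h = inverse (norm h) *\<^sub>R h"

definition uniformity_ell2 :: "('j ell2 \<times> 'j ell2) filter" where
  "uniformity_ell2 = (INF e\<in>{0<..}. principal {(h, k). dist h k < e})"

definition open_ell2 :: "'j ell2 set \<Rightarrow> bool" where
  "open_ell2 U \<longleftrightarrow> (\<forall>h\<in>U. eventually (\<lambda>(h', k). h' = h \<longrightarrow> k \<in> U) uniformity)"

instance
proof
  fix h k l :: "'j ell2" and r s :: real
  show "h + k + l = h + (k + l)" by transfer (simp add: add.assoc)
  show "h + k = k + h" by transfer (simp add: add.commute)
  show "0 + h = h" by transfer simp
  show "- h + h = 0" by transfer simp
  show "h - k = h + - k" by (simp add: minus_ell2_def)
  show "r *\<^sub>R (h + k) = r *\<^sub>R h + r *\<^sub>R k"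
    unfolding scaleR_ell2_def by transfer (simp add: algebra_simps)
  show "(r + s) *\<^sub>R h = r *\<^sub>R h + s *\<^sub>R h"
    unfolding scaleR_ell2_def by transfer (simp add: algebra_simps)
  show "r *\<^sub>R s *\<^sub>R h = (r * s) *\<^sub>R h"
    unfolding scaleR_ell2_def by transfer (simp add: algebra_simps)
  show "1 *\<^sub>R h = h"
    unfolding scaleR_ell2_def by transfer simp
  show "dist h k = norm (h - k)" by (rule dist_ell2_def)
  show "sgn h = inverse (norm h) *\<^sub>R h" by (rule sgn_ell2_def)
  show "uniformity = (INF e\<in>{0<..}. principal {(h :: 'j ell2, k). dist h k < e})"
    by (rule uniformity_ell2_def)
  show "open U \<longleftrightarrow> (\<forall>h\<in>U. eventually (\<lambda>(h', k). h' = h \<longrightarrow> k \<in> U) uniformity)"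
    for U :: "'j ell2 set"
    by (rule open_ell2_def)
  show "norm h = 0 \<longleftrightarrow> h = 0"
  proof
    assume "norm h = 0"
    then have *: "(\<Sum>\<^sub>\<infinity>j. (cmod (coord h j))\<^sup>2) \<le> 0"
      by (simp add: norm_ell2_def)
    have "(cmod (coord h j))\<^sup>2 = 0" for j
      by (rule nonneg_infsum_le_0D[OF *])
        (use square_summable_coord[of h] in \<open>auto simp: square_summable_def\<close>)
    then show "h = 0"
      by (auto simp: coord_inject[symmetric] zero_ell2.rep_eq)
  qed (simp add: norm_ell2_def zero_ell2.rep_eq)
  show "norm (h + k) \<le> norm h + norm k"
    unfolding norm_ell2_def plus_ell2.rep_eq by (rule square_summable_add) simp_all
  show "norm (r *\<^sub>R h) = \<bar>r\<bar> * norm h"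
    by (simp add: norm_ell2_def scaleR_ell2_def cscale.rep_eq norm_mult power_mult_distrib
        infsum_cmult_right' real_sqrt_mult)
qed

end

interpretation ell2: vector_space "cscale :: complex \<Rightarrow> 'j ell2 \<Rightarrow> 'j ell2"
  by unfold_locales (transfer; simp add: algebra_simps)+


subsection \<open>Unbounded operators in \<open>\<ell>\<^sup>2(J)\<close>\<close>

text \<open>An operator is a partial map with domain \<^term>\<open>dom T\<close>.\<close>

type_synonym 'j ell2_op = "'j ell2 \<rightharpoonup> 'j ell2"

definition linear_op :: "'j ell2_op \<Rightarrow> bool" where
  "linear_op T \<longleftrightarrow> ell2.subspace (dom T) \<and>
     (\<forall>h\<in>dom T. \<forall>k\<in>dom T. the (T (h + k)) = the (T h) + the (T k)) \<and>
     (\<forall>c. \<forall>h\<in>dom T. the (T (c *\<^sub>C h)) = c *\<^sub>C the (T h))"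

definition densely_defined :: "'j ell2_op \<Rightarrow> bool" where
  "densely_defined T \<longleftrightarrow> closure (dom T) = UNIV"

definition op_plus :: "'j ell2_op \<Rightarrow> 'j ell2_op \<Rightarrow> 'j ell2_op" (infixl \<open>\<oplus>\<^sub>o\<^sub>p\<close> 65) where
  "S \<oplus>\<^sub>o\<^sub>p T = (\<lambda>h. if h \<in> dom S \<inter> dom T then Some (the (S h) + the (T h)) else None)"

definition shifted :: "'j ell2_op \<Rightarrow> complex \<Rightarrow> 'j ell2 \<Rightarrow> 'j ell2" where
  "shifted T z h = the (T h) - z *\<^sub>C h"

text \<open>\<open>(T - z)\<^sup>-\<^sup>1\<close>, meaningful when \<open>T - z\<close> maps \<^term>\<open>dom T\<close> bijectively onto \<open>\<ell>\<^sup>2(J)\<close>.\<close>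

definition resolvent :: "'j ell2_op \<Rightarrow> complex \<Rightarrow> 'j ell2 \<Rightarrow> 'j ell2" where
  "resolvent T z = inv_into (dom T) (shifted T z)"

text \<open>For complex linear \<open>T\<close> the resolvent is automatically complex homogeneous, so the
  real notion \<^const>\<open>bounded_linear\<close> only adds boundedness here.\<close>

definition resolvent_set :: "'j ell2_op \<Rightarrow> complex set" where
  "resolvent_set T =
     {z. bij_betw (shifted T z) (dom T) UNIV \<and> bounded_linear (resolvent T z)}"

text \<open>The point \<open>z = a\<close>, where the argument is undefined, is not in the region below:
  \<^term>\<open>Arg 0 = 0\<close> while \<open>\<theta> > 0\<close>.\<close>

definition sectorial :: "'j ell2_op \<Rightarrow> bool" where
  "sectorial T \<longleftrightarrow> linear_op T \<and> densely_defined T \<and>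
     (\<exists>(a::real) (M::real) (\<theta>::real). 0 < M \<and> 0 < \<theta> \<and> \<theta> < pi / 2 \<and>
        (\<forall>z::complex. \<bar>Arg (z - of_real a)\<bar> \<ge> \<theta> \<longrightarrow>
           z \<in> resolvent_set T \<and> onorm (resolvent T z) \<le> M / cmod (z - of_real a)))"

definition diag_op :: "('j \<Rightarrow> complex) \<Rightarrow> 'j ell2_op" where
  "diag_op l = (\<lambda>h. if square_summable (\<lambda>j. l j * coord h j)
                    then Some (Abs_ell2 (\<lambda>j. l j * coord h j)) else None)"


subsection \<open>Series over a directed index set and the operator \<open>f \<oslash> g\<close>\<close>

text \<open>A series over a directed set is the limit of the net of its partial sums over the
  sections \<open>{..j}\<close>; an infinite section is summed unconditionally.  For \<open>J = \<nat>\<close> this is ordinary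
  (possibly conditional) convergence.  For the indiscrete preorder, where \<open>i \<le> j\<close> always holds,
  it is unordered summation.  The library filter \<^term>\<open>at_top\<close> is only available for
  antisymmetric orders, hence the copy \<open>towards_top\<close> for directed preorders.\<close>

definition directed_UNIV :: "'j::preorder itself \<Rightarrow> bool" where
  "directed_UNIV _ \<longleftrightarrow> (\<forall>i j :: 'j. \<exists>k. i \<le> k \<and> j \<le> k)"

definition towards_top :: "'j::preorder filter" where
  "towards_top = (INF k. principal {k..})"

definition net_has_sum :: "('j::preorder \<Rightarrow> complex) \<Rightarrow> complex \<Rightarrow> bool" where
  "net_has_sum x s \<longleftrightarrow>
     (\<forall>j. x summable_on {..j}) \<and> ((\<lambda>j. \<Sum>\<^sub>\<infinity>i\<in>{..j}. x i) \<longlongrightarrow> s) towards_top"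

definition net_convergent :: "('j::preorder \<Rightarrow> complex) \<Rightarrow> bool" where
  "net_convergent x \<longleftrightarrow> (\<exists>s. net_has_sum x s)"

definition net_sum :: "('j::preorder \<Rightarrow> complex) \<Rightarrow> complex" where
  "net_sum x = (THE s. net_has_sum x s)"

definition oslash :: "'j::preorder ell2 \<Rightarrow> ('j \<Rightarrow> complex) \<Rightarrow> 'j ell2_op" (infix \<open>\<oslash>\<close> 70) where
  "f \<oslash> g = (\<lambda>h. if net_convergent (\<lambda>j. coord h j * cnj (g j))
                  then Some (net_sum (\<lambda>j. coord h j * cnj (g j)) *\<^sub>C f) else None)"

end

theory Submission
  imports Defs
begin

text \<open>
  Write \<open>D\<close> for the diagonal operator and \<open>G h\<close> for the series \<open>\<Sum>j. h\<^sub>j cnj (g\<^sub>j)\<close>. On the domain of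
  \<open>D\<close> the series converges absolutely: \<open>h\<^sub>j cnj (g\<^sub>j)\<close> has the absolute value of the product of
  \<open>(\<lambda>\<^sub>j - z\<^sub>0) h\<^sub>j\<close> and \<open>q\<^sub>j = g\<^sub>j / (\<lambda>\<^sub>j - z\<^sub>0)\<close>, both square summable. Absolute convergence makes the
  sum independent of the direction on \<open>J\<close> (\<open>net_sum_abs_summable\<close>), so the sum of the two
  operators is \<open>T h = D h + G h f\<close> with the domain of \<open>D\<close>.

  Let \<open>R = (D - z)\<^sup>-\<^sup>1\<close>. Solving \<open>(D - z) h + G h f = k\<close> by applying \<open>R\<close> and then \<open>G\<close> gives the
  Sherman-Morrison formula
  \<open>(T - z)\<^sup>-\<^sup>1 k = R k - G (R k) / (1 + G (R f)) R f\<close>, valid whenever \<open>1 + G (R f)\<close> is nonzero.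
  If \<open>\<bar>G (R k)\<bar> \<le> C \<parallel>k\<parallel>\<close> and \<open>\<bar>1 + G (R f)\<bar> \<ge> 1/2\<close>, the resolvent of \<open>T\<close> is larger than that of
  \<open>D\<close> by at most the factor \<open>1 + 2 C \<parallel>f\<parallel>\<close> (\<open>rank_one_perturbation.resolvent_perturbed\<close>).

  Both estimates hold in the sectorial region of \<open>D\<close> with vertex \<open>a\<close>, far from \<open>a\<close>. There
  \<open>\<bar>\<lambda>\<^sub>j - z\<bar> \<ge> \<bar>z - a\<bar> / M\<close>, and therefore \<open>\<bar>\<lambda>\<^sub>j - z\<^sub>0\<bar> / \<bar>\<lambda>\<^sub>j - z\<bar>\<close> is bounded uniformly in \<open>j\<close> and \<open>z\<close>.
  This bounds the terms of \<open>G (R k)\<close> by a constant times \<open>\<bar>k\<^sub>j\<bar> \<bar>q\<^sub>j\<bar>\<close>, and Cauchy-Schwarz yields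
  \<open>C\<close>. Since each single term of \<open>G (R f)\<close> tends to 0 as \<open>z\<close> goes to infinity, dominated
  convergence gives \<open>G (R f) \<rightarrow> 0\<close>.

  Finally, moving the vertex of the sector far enough to the left excludes a neighbourhood of \<open>a\<close>
  at the cost of a constant factor in the resolvent estimate (\<open>sectorial_if_far\<close>).
\<close>


section \<open>Unordered sums and series over directed sets\<close>

lemma infsum_tail_less:
  fixes s :: "'a \<Rightarrow> real"
  assumes s: "s summable_on UNIV" and e: "0 < e"
  obtains F where "finite F" "infsum s (- F) < e"
proof -
  obtain F where F: "finite F" "dist (sum s F) (infsum s UNIV) \<le> e / 2"
    using infsum_finite_approximation[OF s, of "e / 2"] e by auto
  have "infsum s (F \<union> - F) = infsum s F + infsum s (- F)"
    using F s by (intro infsum_Un_disjoint) (auto intro: summable_on_subset_banach)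
  then have "infsum s UNIV = sum s F + infsum s (- F)"
    using F by simp
  with F have "\<bar>infsum s (- F)\<bar> \<le> e / 2"
    by (simp add: dist_real_def)
  with e have "infsum s (- F) < e"
    by linarith
  with F show thesis
    by (blast intro: that)
qed

lemma abs_summable_dominated:
  fixes x :: "'a \<Rightarrow> complex"
  assumes "s summable_on A" "\<And>j. j \<in> A \<Longrightarrow> norm (x j) \<le> s j"
  shows "(\<lambda>j. norm (x j)) summable_on A" "x summable_on A" "norm (infsum x A) \<le> infsum s A"
proof -
  show abs: "(\<lambda>j. norm (x j)) summable_on A"
    by (rule summable_on_comparison_test[OF assms(1)]) (use assms in auto)
  then show "x summable_on A"
    by (rule abs_summable_summable)
  show "norm (infsum x A) \<le> infsum s A"
    by (rule norm_infsum_le[OF has_sum_infsum[OF \<open>x summable_on A\<close>] has_sum_infsum[OF assms(1)]])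
       (use assms in auto)
qed

text \<open>Dominated convergence for unordered sums along an arbitrary filter: the majorant makes the
  sum outside a finite set small uniformly, and the finite part tends to 0 termwise.\<close>
lemma tendsto_0_infsum_dominated:
  fixes u :: "'b \<Rightarrow> 'a \<Rightarrow> complex"
  assumes s: "s summable_on UNIV"
    and le: "\<forall>\<^sub>F z in \<F>. \<forall>j. norm (u z j) \<le> s j"
    and lim: "\<And>j. ((\<lambda>z. u z j) \<longlongrightarrow> 0) \<F>"
  shows "((\<lambda>z. \<Sum>\<^sub>\<infinity>j. u z j) \<longlongrightarrow> 0) \<F>"
proof (rule tendstoI)
  fix e :: real
  assume e: "0 < e"
  then obtain F where F: "finite F" "infsum s (- F) < e / 2"
    using infsum_tail_less[OF s, of "e / 2"] by auto
  have "((\<lambda>z. \<Sum>j\<in>F. u z j) \<longlongrightarrow> (\<Sum>j\<in>F. 0)) \<F>"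
    by (intro tendsto_sum lim)
  then have "\<forall>\<^sub>F z in \<F>. norm (\<Sum>j\<in>F. u z j) < e / 2"
    using tendstoD[of "\<lambda>z. \<Sum>j\<in>F. u z j" 0 \<F> "e / 2"] e by simp
  with le show "\<forall>\<^sub>F z in \<F>. dist (\<Sum>\<^sub>\<infinity>j. u z j) 0 < e"
  proof eventually_elim
    case (elim z)
    have sF: "s summable_on - F"
      using s by (rule summable_on_subset_banach) simp
    have "infsum (u z) (F \<union> - F) = infsum (u z) F + infsum (u z) (- F)"
      using F elim abs_summable_dominated(2)[OF sF, of "u z"]
      by (intro infsum_Un_disjoint) auto
    then have "norm (infsum (u z) UNIV) \<le> norm (sum (u z) F) + norm (infsum (u z) (- F))"
      using F by (simp add: norm_triangle_ineq)
    also have "\<dots> < e / 2 + e / 2"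
      using elim F abs_summable_dominated(3)[OF sF, of "u z"]
      by (intro add_strict_mono) (auto intro: le_less_trans)
    finally show ?case
      by simp
  qed
qed

lemma eventually_towards_top:
  assumes "directed_UNIV TYPE('j::preorder)"
  shows "eventually P (towards_top :: 'j filter) \<longleftrightarrow> (\<exists>k. \<forall>j\<ge>k. P j)"
  unfolding towards_top_def
proof (subst eventually_INF_base)
  fix a b :: 'j
  obtain k where "a \<le> k" "b \<le> k"
    using assms by (auto simp: directed_UNIV_def)
  then have "{k..} \<subseteq> {a..} \<inter> {b..}"
    by (meson IntI atLeast_iff order_trans subsetI)
  then show "\<exists>x\<in>UNIV. principal {x..} \<le> inf (principal {a..}) (principal {b..})"
    by (intro bexI[of _ k]) simp_all
qed (auto simp: eventually_principal)

lemma directed_finite_upper_bound: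
  assumes "directed_UNIV TYPE('j::preorder)" "finite (F :: 'j set)"
  shows "\<exists>k. F \<subseteq> {..k}"
  using assms(2)
proof induction
  case (insert i F)
  then obtain k where k: "F \<subseteq> {..k}"
    by auto
  obtain l where "i \<le> l" "k \<le> l"
    using assms(1) by (auto simp: directed_UNIV_def)
  with k have "insert i F \<subseteq> {..l}"
    by (meson atMost_iff insert_subset order_trans subset_iff)
  then show ?case ..
qed simp

text \<open>A finite set carrying all but \<open>\<epsilon>\<close> of the absolute mass lies in some section \<open>{..k}\<close> by
  directedness, so every later section misses at most \<open>\<epsilon>\<close> of the unordered sum.\<close>
lemma net_sum_abs_summable:
  fixes x :: "'j::preorder \<Rightarrow> complex"
  assumes dir: "directed_UNIV TYPE('j)" and x: "(\<lambda>j. norm (x j)) summable_on UNIV"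
  shows "net_convergent x" "net_sum x = (\<Sum>\<^sub>\<infinity>j. x j)"
proof -
  have on: "(\<lambda>j. norm (x j)) summable_on A" for A
    using x by (rule summable_on_subset_banach) simp
  then have on': "x summable_on A" for A
    by (rule abs_summable_summable)
  have "((\<lambda>j. \<Sum>\<^sub>\<infinity>i\<in>{..j}. x i) \<longlongrightarrow> infsum x UNIV) towards_top"
  proof (rule tendstoI)
    fix e :: real
    assume "0 < e"
    then obtain F where F: "finite F" "(\<Sum>\<^sub>\<infinity>j\<in>- F. norm (x j)) < e"
      using infsum_tail_less[OF x] by auto
    obtain k where k: "F \<subseteq> {..k}"
      using directed_finite_upper_bound[OF dir F(1)] by auto
    have "dist (infsum x {..j}) (infsum x UNIV) < e" if "k \<le> j" for j
    proof -
      have "infsum x ({..j} \<union> - {..j}) = infsum x {..j} + infsum x (- {..j})"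
        by (intro infsum_Un_disjoint on') auto
      then have "dist (infsum x {..j}) (infsum x UNIV) = norm (infsum x (- {..j}))"
        by (simp add: dist_norm)
      also have "\<dots> \<le> (\<Sum>\<^sub>\<infinity>i\<in>- {..j}. norm (x i))"
        by (rule norm_infsum_bound[OF on])
      also have "\<dots> \<le> (\<Sum>\<^sub>\<infinity>i\<in>- F. norm (x i))"
      proof -
        have "F \<subseteq> {..j}"
          using k that by (meson atMost_iff order_trans subset_iff)
        then show ?thesis
          by (intro infsum_mono2 on) auto
      qed
      finally show ?thesis
        using F by simp
    qed
    then show "\<forall>\<^sub>F j in towards_top. dist (infsum x {..j}) (infsum x UNIV) < e"
      unfolding eventually_towards_top[OF dir] by blast
  qed
  then have sum: "net_has_sum x (infsum x UNIV)"
    using on' by (simp add: net_has_sum_def)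
  then show "net_convergent x"
    by (auto simp: net_convergent_def)
  have "(towards_top :: 'j filter) \<noteq> bot"
    using eventually_towards_top[OF dir, of "\<lambda>_. False"]
    unfolding trivial_limit_def by blast
  then have "s = infsum x UNIV" if "net_has_sum x s" for s
    using that sum unfolding net_has_sum_def by (blast intro: tendsto_unique)
  with sum show "net_sum x = (\<Sum>\<^sub>\<infinity>j. x j)"
    unfolding net_sum_def by (rule the_equality)
qed


section \<open>The space of square summable functions\<close>

lemma norm_cscale [simp]: "norm (c *\<^sub>C h) = cmod c * norm h"
  by (simp add: norm_ell2_def cscale.rep_eq norm_mult power_mult_distrib
      infsum_cmult_right' real_sqrt_mult)

lemma scaleR_eq_cscale: "r *\<^sub>R h = of_real r *\<^sub>C h" for h :: "'j ell2"
  by (rule scaleR_ell2_def)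

lemma coord_diff: "coord (h - k) j = coord h j - coord k j"
  unfolding minus_ell2_def plus_ell2.rep_eq uminus_ell2.rep_eq by simp

text \<open>The Cauchy-Schwarz inequality, obtained from its version for finite sums.\<close>
lemma infsum_mult_le_norm:
  assumes q: "square_summable q"
  shows "(\<lambda>j. cmod (coord k j) * cmod (q j)) summable_on UNIV"
    and "(\<Sum>\<^sub>\<infinity>j. cmod (coord k j) * cmod (q j)) \<le> norm k * norm (Abs_ell2 q)"
proof -
  have coord_q: "coord (Abs_ell2 q) = q"
    using q by (simp add: Abs_ell2_inverse)
  have bound: "(\<Sum>j\<in>F. cmod (coord k j) * cmod (q j)) \<le> norm k * norm (Abs_ell2 q)"
    if "finite F" for F
  proof -
    have "(\<Sum>j\<in>F. cmod (coord k j) * cmod (q j))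
        \<le> L2_set (\<lambda>j. cmod (coord k j)) F * L2_set (\<lambda>j. cmod (q j)) F"
      using L2_set_mult_ineq[of "\<lambda>j. cmod (coord k j)" "\<lambda>j. cmod (q j)" F] by simp
    also have "\<dots> \<le> norm k * norm (Abs_ell2 q)"
      unfolding norm_ell2_def coord_q
      by (rule mult_mono[OF L2_set_le_sqrt_infsum[OF square_summable_coord that]
            L2_set_le_sqrt_infsum[OF q that]]) (simp_all add: infsum_nonneg)
    finally show ?thesis .
  qed
  show *: "(\<lambda>j. cmod (coord k j) * cmod (q j)) summable_on UNIV"
  proof (rule nonneg_bdd_above_summable_on)
    show "bdd_above (sum (\<lambda>j. cmod (coord k j) * cmod (q j)) ` {F. F \<subseteq> UNIV \<and> finite F})"
      by (rule bdd_aboveI2[where M = "norm k * norm (Abs_ell2 q)"]) (simp add: bound)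
  qed simp
  show "(\<Sum>\<^sub>\<infinity>j. cmod (coord k j) * cmod (q j)) \<le> norm k * norm (Abs_ell2 q)"
    by (rule infsum_le_finite_sums[OF *]) (rule bound)
qed

definition basis_vector :: "'j \<Rightarrow> 'j ell2" where
  "basis_vector j = Abs_ell2 (\<lambda>i. if i = j then 1 else 0)"

lemma coord_basis_vector: "coord (basis_vector j) i = (if i = j then 1 else 0)"
proof -
  have "(\<lambda>i. (cmod (if i = j then 1 else 0))\<^sup>2) summable_on UNIV"
    by (rule finite_nonzero_values_imp_summable_on) simp
  then show ?thesis
    by (simp add: basis_vector_def Abs_ell2_inverse square_summable_def)
qed

lemma norm_basis_vector [simp]: "norm (basis_vector j) = 1"
proof -
  have "(\<Sum>\<^sub>\<infinity>i. (cmod (coord (basis_vector j) i))\<^sup>2) = (\<Sum>\<^sub>\<infinity>i\<in>{j}. 1 :: real)"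
    by (rule infsum_cong_neutral) (simp_all add: coord_basis_vector)
  then show ?thesis
    by (simp add: norm_ell2_def)
qed


section \<open>Resolvents and rank one perturbations\<close>

lemma shifted_resolvent:
  assumes "z \<in> resolvent_set T"
  shows "resolvent T z k \<in> dom T" "shifted T z (resolvent T z k) = k"
    and "h \<in> dom T \<Longrightarrow> resolvent T z (shifted T z h) = h"
proof -
  have bij: "bij_betw (shifted T z) (dom T) UNIV"
    using assms by (simp add: resolvent_set_def)
  then have k: "k \<in> shifted T z ` dom T" and inj: "inj_on (shifted T z) (dom T)"
    by (auto simp: bij_betw_def)
  from k show "resolvent T z k \<in> dom T"
    unfolding resolvent_def by (rule inv_into_into)
  from k show "shifted T z (resolvent T z k) = k"
    unfolding resolvent_def by (rule f_inv_into_f)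
  from inj show "h \<in> dom T \<Longrightarrow> resolvent T z (shifted T z h) = h"
    unfolding resolvent_def by (rule inv_into_f_f)
qed

lemma linear_op_closed:
  assumes "linear_op T"
  shows "h \<in> dom T \<Longrightarrow> k \<in> dom T \<Longrightarrow> h + k \<in> dom T"
    and "h \<in> dom T \<Longrightarrow> k \<in> dom T \<Longrightarrow> h - k \<in> dom T"
    and "h \<in> dom T \<Longrightarrow> c *\<^sub>C h \<in> dom T"
proof -
  have sub: "ell2.subspace (dom T)"
    using assms by (simp add: linear_op_def)
  show "h \<in> dom T \<Longrightarrow> k \<in> dom T \<Longrightarrow> h + k \<in> dom T"
    by (rule ell2.subspace_add[OF sub])
  show "h \<in> dom T \<Longrightarrow> k \<in> dom T \<Longrightarrow> h - k \<in> dom T"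
    by (rule ell2.subspace_diff[OF sub])
  show "h \<in> dom T \<Longrightarrow> c *\<^sub>C h \<in> dom T"
    by (rule ell2.subspace_scale[OF sub])
qed

lemma shifted_linear:
  assumes "linear_op T"
  shows "h \<in> dom T \<Longrightarrow> k \<in> dom T \<Longrightarrow> shifted T z (h + k) = shifted T z h + shifted T z k"
    and "h \<in> dom T \<Longrightarrow> shifted T z (c *\<^sub>C h) = c *\<^sub>C shifted T z h"
  using assms unfolding linear_op_def shifted_def
  by (auto simp: ell2.scale_right_distrib ell2.scale_right_diff_distrib ell2.scale_left_commute)

lemma resolvent_cscale:
  assumes "linear_op T" "z \<in> resolvent_set T"
  shows "resolvent T z (c *\<^sub>C k) = c *\<^sub>C resolvent T z k"
  using assms by (metis linear_op_closed(3) shifted_linear(2) shifted_resolvent)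

lemma norm_resolvent_le:
  assumes "z \<in> resolvent_set T" "onorm (resolvent T z) \<le> m"
  shows "norm (resolvent T z k) \<le> m * norm k"
proof -
  have "norm (resolvent T z k) \<le> onorm (resolvent T z) * norm k"
    using assms by (intro onorm) (simp add: resolvent_set_def)
  also have "\<dots> \<le> m * norm k"
    using assms by (intro mult_right_mono) auto
  finally show ?thesis .
qed

text \<open>The functional \<open>G\<close> is unbounded in general; it only has to be linear on the domain of \<open>D\<close>.\<close>
locale rank_one_perturbation =
  fixes D T :: "'j ell2_op" and G :: "'j ell2 \<Rightarrow> complex" and f :: "'j ell2"
  assumes D_linear: "linear_op D"
    and dom_T: "dom T = dom D"
    and T_eq: "h \<in> dom D \<Longrightarrow> the (T h) = the (D h) + G h *\<^sub>C f"
    and G_add: "h \<in> dom D \<Longrightarrow> k \<in> dom D \<Longrightarrow> G (h + k) = G h + G k"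
    and G_cscale: "h \<in> dom D \<Longrightarrow> G (c *\<^sub>C h) = c * G h"
begin

lemma G_diff: "h \<in> dom D \<Longrightarrow> k \<in> dom D \<Longrightarrow> G (h - k) = G h - G k"
  using G_add[of "h - k" k] linear_op_closed[OF D_linear] by (simp add: algebra_simps)

lemma linear_op_perturbed: "linear_op T"
  using D_linear unfolding linear_op_def dom_T
  by (auto simp: T_eq[unfolded dom_def] G_add G_cscale ell2.subspace_add ell2.subspace_scale
      ell2.scale_left_distrib ell2.scale_right_distrib T_eq)

text \<open>The Sherman-Morrison formula provides a two-sided inverse \<open>S\<close> of \<open>T - z\<close>; the lower bound on
  its denominator turns the bounds on \<open>R\<close> and on \<open>G \<circ> R\<close> into one on \<open>S\<close>.\<close>
lemma resolvent_perturbed: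
  assumes z: "z \<in> resolvent_set D"
    and m: "onorm (resolvent D z) \<le> m"
    and C: "\<And>k. cmod (G (resolvent D z k)) \<le> C * norm k"
    and half: "1 / 2 \<le> cmod (1 + G (resolvent D z f))"
  shows "z \<in> resolvent_set T" "onorm (resolvent T z) \<le> m * (1 + 2 * C * norm f)"
proof -
  let ?R = "resolvent D z" and ?A = "shifted D z"
  define \<phi> where "\<phi> = 1 + G (?R f)"
  define S where "S k = ?R k - (G (?R k) / \<phi>) *\<^sub>C ?R f" for k
  note [simp] = shifted_resolvent[OF z] linear_op_closed[OF D_linear]
  note R_bl = z[unfolded resolvent_set_def, simplified, THEN conjunct2]
  have \<phi>: "\<phi> \<noteq> 0"
    using half by (auto simp: \<phi>_def)
  have shifted_T: "shifted T z h = ?A h + G h *\<^sub>C f" if "h \<in> dom D" for h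
    using that by (simp add: shifted_def T_eq)
  have A_diff: "?A (h - k) = ?A h - ?A k" if "h \<in> dom D" "k \<in> dom D" for h k
    using shifted_linear(1)[OF D_linear, of "h - k" k z] that by (simp add: algebra_simps)
  have S_dom: "S k \<in> dom D" for k
    by (simp add: S_def)
  have right: "shifted T z (S k) = k" for k
  proof -
    \<comment> \<open>The coefficient in \<open>S\<close> is the value of \<open>G\<close> on \<open>S k\<close>, because \<open>G (R f) = \<phi> - 1\<close>.\<close>
    have "G (S k) = G (?R k) - G (?R k) / \<phi> * (\<phi> - 1)"
      by (simp add: S_def G_diff G_cscale \<phi>_def)
    then have "G (S k) = G (?R k) / \<phi>"
      using \<phi> by (simp add: field_simps)
    moreover have "?A (S k) = k - (G (?R k) / \<phi>) *\<^sub>C f"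
      by (simp add: S_def A_diff shifted_linear(2)[OF D_linear])
    ultimately show ?thesis
      by (simp add: shifted_T S_dom)
  qed
  \<comment> \<open>Here \<open>G (R ((T - z) h)) = G h + G h (\<phi> - 1)\<close>, so the coefficient in \<open>S\<close> is \<open>G h\<close> again.\<close>
  have left: "S (shifted T z h) = h" if h: "h \<in> dom D" for h
  proof -
    have R: "?R (shifted T z h) = h + G h *\<^sub>C ?R f"
      using h by (simp add: shifted_T linear_simps(1)[OF R_bl] resolvent_cscale[OF D_linear z])
    have "G (?R (shifted T z h)) = G h * \<phi>"
      using h by (simp add: R G_add G_cscale \<phi>_def algebra_simps)
    then show ?thesis
      using \<phi> by (simp add: S_def R)
  qed
  have bij: "bij_betw (shifted T z) (dom T) UNIV"
    by (rule bij_betw_byWitness[where f' = S]) (simp_all add: dom_T left right S_dom image_subset_iff del: domIff)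
  have res: "resolvent T z = S"
  proof
    fix k
    show "resolvent T z k = S k"
      unfolding resolvent_def using bij S_dom right
      by (intro inv_into_f_eq) (auto simp: bij_betw_def dom_T)
  qed
  have m0: "0 \<le> m"
    using onorm_pos_le[OF R_bl] m by linarith
  have S_bound: "norm (S k) \<le> m * (1 + 2 * C * norm f) * norm k" for k
  proof -
    have "cmod (G (?R k) / \<phi>) = cmod (G (?R k)) / cmod \<phi>"
      by (rule norm_divide)
    also have "\<dots> \<le> C * norm k / (1 / 2)"
      using C[of k] half by (intro frac_le) (auto intro: order_trans[OF norm_ge_zero] simp: \<phi>_def)
    finally have quot: "cmod (G (?R k) / \<phi>) \<le> 2 * C * norm k"
      by simp
    have "norm (S k) \<le> norm (?R k) + cmod (G (?R k) / \<phi>) * norm (?R f)"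
      unfolding S_def by (metis norm_cscale norm_triangle_ineq4)
    also have "\<dots> \<le> m * norm k + 2 * C * norm k * (m * norm f)"
      using order_trans[OF norm_ge_zero quot] norm_resolvent_le[OF z m] quot
      by (intro add_mono mult_mono) simp_all
    finally show ?thesis
      by (simp add: algebra_simps)
  qed
  have "bounded_linear S"
  proof (rule bounded_linear_intro)
    show "S (h + k) = S h + S k" for h k
      by (simp add: S_def linear_simps(1)[OF R_bl] G_add add_divide_distrib ell2.scale_left_distrib)
    show "S (r *\<^sub>R k) = r *\<^sub>R S k" for r k
      by (simp add: S_def scaleR_eq_cscale resolvent_cscale[OF D_linear z] G_cscale
          ell2.scale_right_diff_distrib)
    show "norm (S k) \<le> norm k * (m * (1 + 2 * C * norm f))" for k
      using S_bound[of k] by (simp add: mult.commute)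
  qed
  with bij res show "z \<in> resolvent_set T"
    by (simp add: resolvent_set_def)
  show "onorm (resolvent T z) \<le> m * (1 + 2 * C * norm f)"
    unfolding res using m0 order_trans[OF norm_ge_zero C[of f]] S_bound
    by (intro onorm_bound) simp_all
qed

end


section \<open>Sectors\<close>

text \<open>The cosine decreases on \<open>[0, \<pi>]\<close>, which turns the condition on the argument into an inequality
  between \<open>Re z\<close> and \<open>\<bar>z\<bar>\<close> that behaves well under translation.\<close>
lemma abs_Arg_ge_iff:
  assumes "z \<noteq> 0" "0 \<le> \<theta>" "\<theta> \<le> pi"
  shows "\<theta> \<le> \<bar>Arg z\<bar> \<longleftrightarrow> Re z \<le> cmod z * cos \<theta>"
proof -
  have "\<bar>Arg z\<bar> \<le> pi"
    using Arg_bounded[of z] by auto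
  then have "\<theta> \<le> \<bar>Arg z\<bar> \<longleftrightarrow> cos (Arg z) \<le> cos \<theta>"
    using cos_mono_le_eq[of "\<bar>Arg z\<bar>" \<theta>] assms by simp
  also have "\<dots> \<longleftrightarrow> Re z \<le> cmod z * cos \<theta>"
    using assms by (simp add: cos_Arg field_simps)
  finally show ?thesis .
qed

text \<open>Put \<open>u = z - a\<close> and \<open>s = a - b > 0\<close>. The hypothesis says \<open>Re u + s \<le> \<bar>u + s\<bar> cos \<theta>\<close>, which is
  at most \<open>(\<bar>u\<bar> + s) cos \<theta>\<close>. Hence \<open>Re u\<close> stays below \<open>\<bar>u\<bar> cos \<theta>\<close> by the margin
  \<open>s (1 - cos \<theta>) = 2 r\<close>. Dropping the margin gives the condition at \<open>a\<close>; and since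
  \<open>\<bar>u\<bar> cos \<theta> - Re u \<le> 2 \<bar>u\<bar>\<close>, the margin forces \<open>\<bar>u\<bar> \<ge> r\<close>.\<close>
lemma sector_shift:
  fixes z :: complex and a r \<theta> :: real
  assumes \<theta>: "0 < \<theta>" "\<theta> < pi / 2" and r: "0 < r"
    and b: "b = a - 2 * r / (1 - cos \<theta>)"
    and z: "\<theta> \<le> \<bar>Arg (z - of_real b)\<bar>"
  shows "\<theta> \<le> \<bar>Arg (z - of_real a)\<bar>" "r \<le> cmod (z - of_real a)"
    and "cmod (z - of_real b) \<le> (1 + 2 / (1 - cos \<theta>)) * cmod (z - of_real a)"
proof -
  define s where "s = 2 * r / (1 - cos \<theta>)"
  define u where "u = z - of_real a"
  have c: "0 \<le> cos \<theta>" "cos \<theta> < 1"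
    using \<theta> cos_monotone_0_pi[of 0 \<theta>] by (auto intro!: cos_ge_zero)
  have s: "0 < s" "s * (1 - cos \<theta>) = 2 * r"
    using c r by (auto simp: s_def)
  have zb: "z - of_real b = u + of_real s"
    by (simp add: u_def b s_def)
  \<comment> \<open>The vertex itself is excluded because \<open>Arg 0 = 0 < \<theta>\<close>.\<close>
  have "u + of_real s \<noteq> 0"
    using z \<theta> unfolding zb by (auto simp: Arg_zero)
  then have "Re u + s \<le> cmod (u + of_real s) * cos \<theta>"
    using z \<theta> abs_Arg_ge_iff[of "u + of_real s" \<theta>] unfolding zb by simp
  also have "\<dots> \<le> (cmod u + s) * cos \<theta>"
    using c s norm_triangle_ineq[of u "of_real s"] by (intro mult_right_mono) auto
  finally have le: "Re u + 2 * r \<le> cmod u * cos \<theta>"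
    using s(2) by (simp add: algebra_simps)
  have "- cmod u \<le> Re u"
    using abs_Re_le_cmod[of u] by linarith
  moreover have "cmod u * cos \<theta> \<le> cmod u * 1"
    using c by (intro mult_left_mono) auto
  ultimately show ge: "r \<le> cmod (z - of_real a)"
    using le by (simp add: u_def)
  then have "u \<noteq> 0"
    using r by (auto simp: u_def)
  then show "\<theta> \<le> \<bar>Arg (z - of_real a)\<bar>"
    using le r \<theta> abs_Arg_ge_iff[of u \<theta>] by (simp add: u_def)
  have "cmod (z - of_real b) \<le> cmod u + s"
    using norm_triangle_ineq[of u "of_real s"] s by (simp add: zb)
  also have "s = 2 / (1 - cos \<theta>) * r"
    by (simp add: s_def)
  also have "cmod u + \<dots> \<le> cmod u + 2 / (1 - cos \<theta>) * cmod u"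
    using ge c by (intro add_left_mono mult_left_mono) (auto simp: u_def)
  finally show "cmod (z - of_real b) \<le> (1 + 2 / (1 - cos \<theta>)) * cmod (z - of_real a)"
    by (simp add: u_def algebra_simps)
qed

text \<open>A resolvent estimate that is known only outside a disc around the vertex suffices: the region
  with its vertex moved to the left avoids that disc.\<close>
lemma sectorial_if_far:
  assumes lin: "linear_op T" and dense: "densely_defined T"
    and \<theta>: "0 < \<theta>" "\<theta> < pi / 2" and r: "0 < r"
    and far: "\<And>z. \<theta> \<le> \<bar>Arg (z - of_real a)\<bar> \<Longrightarrow> r \<le> cmod (z - of_real a) \<Longrightarrow>
      z \<in> resolvent_set T \<and> onorm (resolvent T z) \<le> N / cmod (z - of_real a)"
  shows "sectorial T"
proof -
  define b where "b = a - 2 * r / (1 - cos \<theta>)"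
  define c where "c = 1 + 2 / (1 - cos \<theta>)"
  have c: "0 < c"
    unfolding c_def using \<theta> cos_monotone_0_pi[of 0 \<theta>] by (auto intro!: add_pos_pos)
  have "z \<in> resolvent_set T \<and>
      onorm (resolvent T z) \<le> max N 1 * c / cmod (z - of_real b)"
    \<comment> \<open>The maximum makes the constant positive, as sectoriality demands.\<close>
    if z: "\<theta> \<le> \<bar>Arg (z - of_real b)\<bar>" for z
  proof -
    note shift = sector_shift[OF \<theta> r b_def z]
    have pos: "0 < cmod (z - of_real a)" "0 < cmod (z - of_real b)"
      using shift(2) r z \<theta> by (auto simp: Arg_zero)
    have "onorm (resolvent T z) \<le> N / cmod (z - of_real a)"
      using far shift by blast
    also have "\<dots> \<le> max N 1 / cmod (z - of_real a)"
      by (intro divide_right_mono) auto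
    also have "\<dots> = max N 1 * c / (c * cmod (z - of_real a))"
      using c by simp
    also have "\<dots> \<le> max N 1 * c / cmod (z - of_real b)"
      using c pos shift(3) by (intro divide_left_mono) (auto simp: c_def)
    finally show ?thesis
      using far shift by blast
  qed
  moreover have "0 < max N 1 * c"
    using c by simp
  ultimately show ?thesis
    using lin dense \<theta> unfolding sectorial_def by blast
qed


section \<open>Diagonal operators and the functional induced by \<open>g\<close>\<close>

lemma dom_diag_op: "dom (diag_op l) = {h. square_summable (\<lambda>j. l j * coord h j)}"
  by (auto simp: diag_op_def split: if_splits)

lemma coord_shifted_diag_op:
  assumes "h \<in> dom (diag_op l)"
  shows "coord (shifted (diag_op l) z h) j = (l j - z) * coord h j"
proof -
  have "square_summable (\<lambda>j. l j * coord h j)"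
    using assms unfolding dom_diag_op by simp
  then have "coord (the (diag_op l h)) = (\<lambda>j. l j * coord h j)"
    by (simp add: diag_op_def Abs_ell2_inverse)
  then show ?thesis
    by (simp add: shifted_def coord_diff cscale.rep_eq left_diff_distrib)
qed

lemma coord_resolvent_diag_op:
  assumes "z \<in> resolvent_set (diag_op l)"
  shows "(l j - z) * coord (resolvent (diag_op l) z k) j = coord k j"
  using coord_shifted_diag_op[OF shifted_resolvent(1)[OF assms], of z k j]
  unfolding shifted_resolvent(2)[OF assms] by (rule sym)

text \<open>Apply the resolvent to the eigenvector \<open>e\<^sub>j\<close>. In particular \<open>l j \<noteq> z\<close>.\<close>
lemma diag_op_gap:
  assumes z: "z \<in> resolvent_set (diag_op l)" and m: "onorm (resolvent (diag_op l) z) \<le> m"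
  shows "1 \<le> m * cmod (l j - z)"
proof -
  let ?A = "shifted (diag_op l) z" and ?e = "basis_vector j"
  have "(\<lambda>i. l i * coord ?e i) = (\<lambda>i. l j * coord ?e i)"
    by (auto simp: coord_basis_vector)
  then have dom: "?e \<in> dom (diag_op l)"
    unfolding dom_diag_op by (simp add: square_summable_cmult)
  have "?A ?e = (l j - z) *\<^sub>C ?e"
    unfolding coord_inject[symmetric]
    by (rule ext) (simp add: coord_shifted_diag_op[OF dom] cscale.rep_eq coord_basis_vector)
  then have "norm (?A ?e) = cmod (l j - z)"
    by simp
  with norm_resolvent_le[OF z m, of "?A ?e"] show ?thesis
    unfolding shifted_resolvent(3)[OF z dom] by simp
qed

text \<open>Passing from the weight \<open>1 / (l j - z)\<close> to \<open>1 / (l j - z0)\<close>, with \<open>z0\<close> fixed, costs the factor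
  \<open>\<bar>l j - z0\<bar> / \<bar>l j - z\<bar> \<le> 1 + \<bar>z - z0\<bar> / \<bar>l j - z\<bar>\<close>, which is bounded independently of \<open>j\<close>.\<close>
lemma resolvent_diag_op_weighted:
  assumes z: "z \<in> resolvent_set (diag_op l)" and m: "onorm (resolvent (diag_op l) z) \<le> m"
    and z0: "l j \<noteq> z0"
  shows "cmod (coord (resolvent (diag_op l) z k) j * cnj c)
      \<le> (1 + m * cmod (z - z0)) * (cmod (coord k j) * cmod (c / (l j - z0)))"
proof -
  define d where "d = cmod (l j - z)"
  define w where "w = cmod (l j - z0)"
  define h where "h = cmod (coord (resolvent (diag_op l) z k) j)"
  have gap: "1 \<le> m * d"
    using diag_op_gap[OF z m] by (simp add: d_def)
  have hk: "d * h = cmod (coord k j)"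
    unfolding d_def h_def norm_mult[symmetric] coord_resolvent_diag_op[OF z] by (rule refl)
  have w: "0 < w"
    using z0 by (simp add: w_def)
  have "w \<le> d + 1 * cmod (z - z0)"
    using norm_triangle_ineq[of "l j - z" "z - z0"] by (simp add: d_def w_def)
  also have "\<dots> \<le> d + m * d * cmod (z - z0)"
    using gap by (intro add_left_mono mult_right_mono) auto
  finally have "w * (h * cmod c / w) \<le> d * (1 + m * cmod (z - z0)) * (h * cmod c / w)"
    using w by (intro mult_right_mono) (simp_all add: h_def distrib_left mult.left_commute mult.commute)
  then have "h * cmod c \<le> (1 + m * cmod (z - z0)) * (d * h * (cmod c / w))"
    using w by (simp add: mult_ac)
  then show ?thesis
    unfolding hk by (simp add: h_def w_def norm_mult norm_divide)
qed

lemma abs_summable_on_dom_diag_op: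
  assumes h: "h \<in> dom (diag_op l)" and z0: "\<And>j. l j \<noteq> z0"
    and q: "square_summable (\<lambda>j. g j / (l j - z0))"
  shows "(\<lambda>j. cmod (coord h j * cnj (g j))) summable_on UNIV"
proof (rule summable_on_comparison_test)
  show "(\<lambda>j. cmod (coord (shifted (diag_op l) z0 h) j) * cmod (g j / (l j - z0))) summable_on UNIV"
    by (rule infsum_mult_le_norm(1)[OF q])
  show "norm (coord h j * cnj (g j))
      \<le> cmod (coord (shifted (diag_op l) z0 h) j) * cmod (g j / (l j - z0))" for j
    using z0[of j] by (simp add: coord_shifted_diag_op[OF h] norm_mult norm_divide)
qed auto

theorem theorem7p1:
  fixes lam :: "'j::preorder \<Rightarrow> complex" and f :: "'j ell2" and g :: "'j \<Rightarrow> complex"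
  assumes J_directed: "directed_UNIV TYPE('j)"
    and J_countable: "countable (UNIV :: 'j set)"
    and J_infinite: "infinite (UNIV :: 'j set)"
    and D_sectorial: "sectorial (diag_op lam)"
    and g_bound: "\<exists>z\<^sub>0\<in>resolvent_set (diag_op lam).
      (\<lambda>j. (cmod (g j))\<^sup>2 / (cmod (lam j - z\<^sub>0))\<^sup>2) summable_on UNIV"
  shows "sectorial (diag_op lam \<oplus>\<^sub>o\<^sub>p f \<oslash> g) \<and>
    dom (diag_op lam \<oplus>\<^sub>o\<^sub>p f \<oslash> g) = dom (diag_op lam)"
proof -
  let ?D = "diag_op lam" and ?T = "diag_op lam \<oplus>\<^sub>o\<^sub>p f \<oslash> g"
  obtain z0 where z0: "z0 \<in> resolvent_set ?D"
    and g: "(\<lambda>j. (cmod (g j))\<^sup>2 / (cmod (lam j - z0))\<^sup>2) summable_on UNIV"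
    using g_bound by blast
  have lam_z0: "lam j \<noteq> z0" for j
    using diag_op_gap[OF z0 order_refl, of j] by auto
  define q where "q j = g j / (lam j - z0)" for j
  have q: "square_summable q"
    using g by (simp add: square_summable_def q_def norm_divide power_divide)
  define G where "G h = (\<Sum>\<^sub>\<infinity>j. coord h j * cnj (g j))" for h
  have abs: "(\<lambda>j. cmod (coord h j * cnj (g j))) summable_on UNIV" if "h \<in> dom ?D" for h
    using abs_summable_on_dom_diag_op[OF that lam_z0] q unfolding q_def by blast
  have oslash: "(f \<oslash> g) h = Some (G h *\<^sub>C f)" if "h \<in> dom ?D" for h
    using net_sum_abs_summable[OF J_directed abs[OF that]] by (simp add: oslash_def G_def)
  have "dom ?T = dom ?D \<inter> dom (f \<oslash> g)"
    by (auto simp: op_plus_def split: if_splits)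
  also have "\<dots> = dom ?D"
    using oslash by (blast intro: domI)
  finally have dom: "dom ?T = dom ?D" .
  interpret rank_one_perturbation ?D ?T G f
  proof
    show "linear_op ?D"
      using D_sectorial by (simp add: sectorial_def)
    show "dom ?T = dom ?D"
      by (rule dom)
    show "the (?T h) = the (?D h) + G h *\<^sub>C f" if "h \<in> dom ?D" for h
      using that oslash[OF that] by (auto simp: op_plus_def)
    show "G (h + k) = G h + G k" if "h \<in> dom ?D" "k \<in> dom ?D" for h k
      using that unfolding G_def
      by (simp add: plus_ell2.rep_eq ring_distribs infsum_add abs_summable_summable[OF abs])
    show "G (c *\<^sub>C h) = c * G h" if "h \<in> dom ?D" for h c
      unfolding G_def by (simp add: cscale.rep_eq mult.assoc infsum_cmult_right')
  qed
  obtain a M \<theta> where M: "0 < M" and \<theta>: "0 < \<theta>" "\<theta> < pi / 2"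
    and D_res: "\<And>z. \<theta> \<le> \<bar>Arg (z - of_real a)\<bar> \<Longrightarrow>
      z \<in> resolvent_set ?D \<and> onorm (resolvent ?D z) \<le> M / cmod (z - of_real a)"
    using D_sectorial unfolding sectorial_def by blast
  define K where "K = 1 + M * (1 + cmod (of_real a - z0))"
  define C where "C = K * norm (Abs_ell2 q)"
  define \<Sigma> where "\<Sigma> = {z. \<theta> \<le> \<bar>Arg (z - of_real a)\<bar>}"
  have K: "0 \<le> K"
    using M by (simp add: K_def)
  \<comment> \<open>With \<open>m = M / t\<close> for \<open>t = \<bar>z - a\<bar> \<ge> 1\<close>, the factor \<open>1 + m \<bar>z - z0\<bar>\<close> is at most
    \<open>1 + (M / t) (t + \<bar>a - z0\<bar>) \<le> K\<close>: the decay of the resolvent compensates the distance to \<open>z0\<close>.\<close>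
  have term_le: "cmod (coord (resolvent ?D z k) j * cnj (g j))
      \<le> K * (cmod (coord k j) * cmod (q j))"
    if z: "z \<in> \<Sigma>" "1 \<le> cmod (z - of_real a)" for z k j
  proof -
    define t where "t = cmod (z - of_real a)"
    have t: "1 \<le> t"
      using z by (simp add: t_def)
    have "cmod (z - z0) \<le> t + 1 * cmod (of_real a - z0)"
      using norm_triangle_ineq[of "z - of_real a" "of_real a - z0"] by (simp add: t_def)
    also have "\<dots> \<le> t + t * cmod (of_real a - z0)"
      using t by (intro add_left_mono mult_right_mono) auto
    finally have "M / t * cmod (z - z0) \<le> M / t * (t + t * cmod (of_real a - z0))"
      using M t by (intro mult_left_mono) auto
    also have "M / t * (t + t * cmod (of_real a - z0)) = K - 1"
      using t by (simp add: K_def distrib_left)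
    finally have "1 + M / t * cmod (z - z0) \<le> K"
      by simp
    then have "(1 + M / t * cmod (z - z0)) * (cmod (coord k j) * cmod (q j))
        \<le> K * (cmod (coord k j) * cmod (q j))"
      by (intro mult_right_mono) auto
    with resolvent_diag_op_weighted[of z lam "M / t" j z0 k "g j"] D_res[of z] z lam_z0 show ?thesis
      by (auto simp: \<Sigma>_def t_def q_def)
  qed
  have dom_series: "(\<lambda>j. K * (cmod (coord k j) * cmod (q j))) summable_on UNIV" for k
    by (intro summable_on_cmult_right infsum_mult_le_norm(1) q)
  have G_bound: "cmod (G (resolvent ?D z k)) \<le> C * norm k"
    if "z \<in> \<Sigma>" "1 \<le> cmod (z - of_real a)" for z k
  proof -
    have "cmod (G (resolvent ?D z k)) \<le> (\<Sum>\<^sub>\<infinity>j. K * (cmod (coord k j) * cmod (q j)))"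
      unfolding G_def by (rule abs_summable_dominated(3)[OF dom_series term_le[OF that]])
    also have "\<dots> = K * (\<Sum>\<^sub>\<infinity>j. cmod (coord k j) * cmod (q j))"
      by (rule infsum_cmult_right')
    also have "\<dots> \<le> K * (norm k * norm (Abs_ell2 q))"
      using K by (intro mult_left_mono infsum_mult_le_norm(2) q)
    finally show ?thesis
      by (simp add: C_def algebra_simps)
  qed
  \<comment> \<open>Convergence \<open>z \<rightarrow> \<infinity>\<close> inside the sectorial region of \<open>D\<close>.\<close>
  define \<F> where "\<F> = inf at_infinity (principal \<Sigma>)"
  have ev: "\<forall>\<^sub>F z in \<F>. z \<in> \<Sigma> \<and> 1 \<le> cmod (z - of_real a)"
  proof -
    have "\<forall>\<^sub>F z in at_infinity. 1 + cmod (of_real a) \<le> cmod z"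
      by (rule eventually_at_infinityI) auto
    then show ?thesis
      unfolding \<F>_def eventually_inf_principal
    proof eventually_elim
      case (elim z)
      then show ?case
        using norm_triangle_ineq2[of z "of_real a"] by auto
    qed
  qed
  have "((\<lambda>z. G (resolvent ?D z f)) \<longlongrightarrow> 0) \<F>"
    unfolding G_def
  proof (rule tendsto_0_infsum_dominated[OF dom_series[of f]])
    show "\<forall>\<^sub>F z in \<F>. \<forall>j. norm (coord (resolvent ?D z f) j * cnj (g j))
        \<le> K * (cmod (coord f j) * cmod (q j))"
      using ev by eventually_elim (use term_le in auto)
    show "((\<lambda>z. coord (resolvent ?D z f) j * cnj (g j)) \<longlongrightarrow> 0) \<F>" for j
    proof -
      have "filterlim (\<lambda>z. z - lam j) at_infinity at_infinity"
        using tendsto_add_filterlim_at_infinity'[OF filterlim_ident tendsto_const[of "- lam j"]]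
        by simp
      then have "((\<lambda>z. - (coord f j * cnj (g j)) / (z - lam j)) \<longlongrightarrow> 0) at_infinity"
        by (intro tendsto_divide_0[OF tendsto_const])
      then have "((\<lambda>z. - (coord f j * cnj (g j)) / (z - lam j)) \<longlongrightarrow> 0) \<F>"
        unfolding \<F>_def by (rule tendsto_mono[rotated]) simp
      moreover have "\<forall>\<^sub>F z in \<F>. - (coord f j * cnj (g j)) / (z - lam j)
          = coord (resolvent ?D z f) j * cnj (g j)"
        using ev
      proof eventually_elim
        case (elim z)
        then have z: "z \<in> resolvent_set ?D"
          using D_res by (auto simp: \<Sigma>_def)
        have "z \<noteq> lam j"
          using diag_op_gap[OF z order_refl, of j] by auto
        moreover have "- (coord f j * cnj (g j))
            = (z - lam j) * (coord (resolvent ?D z f) j * cnj (g j))"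
          unfolding coord_resolvent_diag_op[OF z, of j f, symmetric]
          by (simp add: algebra_simps)
        ultimately show ?case
          by simp
      qed
      ultimately show ?thesis
        by (rule Lim_transform_eventually)
    qed
  qed
  then have "\<forall>\<^sub>F z in \<F>. cmod (G (resolvent ?D z f)) < 1 / 2"
    using tendstoD[of "\<lambda>z. G (resolvent ?D z f)" 0 \<F> "1 / 2"] by simp
  then obtain B where B: "\<And>z. z \<in> \<Sigma> \<Longrightarrow> B \<le> cmod z \<Longrightarrow> cmod (G (resolvent ?D z f)) < 1 / 2"
    unfolding \<F>_def eventually_inf_principal eventually_at_infinity by blast
  \<comment> \<open>A radius at which both the uniform bound on \<open>G \<circ> R\<close> and \<open>\<bar>G (R f)\<bar> < 1 / 2\<close> are in force.\<close>
  define r where "r = max 1 (B + cmod (of_real a))"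
  have "sectorial ?T"
  proof (rule sectorial_if_far[OF linear_op_perturbed _ \<theta>])
    show "densely_defined ?T"
      using D_sectorial by (simp add: sectorial_def densely_defined_def dom)
    show "0 < r"
      by (simp add: r_def)
    fix z :: complex
    assume z: "\<theta> \<le> \<bar>Arg (z - of_real a)\<bar>" and far: "r \<le> cmod (z - of_real a)"
    have \<Sigma>: "z \<in> \<Sigma>" and far1: "1 \<le> cmod (z - of_real a)"
      using z far by (auto simp: \<Sigma>_def r_def)
    have "B \<le> cmod z"
      using far norm_triangle_ineq4[of z "of_real a"] by (simp add: r_def)
    then have "1 / 2 \<le> cmod (1 + G (resolvent ?D z f))"
      using B[OF \<Sigma>] norm_diff_ineq[of 1 "G (resolvent ?D z f)"] by auto
    with resolvent_perturbed[of z "M / cmod (z - of_real a)" C] D_res[OF z] G_bound[OF \<Sigma> far1]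
    show "z \<in> resolvent_set ?T \<and>
        onorm (resolvent ?T z) \<le> M * (1 + 2 * C * norm f) / cmod (z - of_real a)"
      by simp
  qed
  with dom show ?thesis
    by simp
qed

end
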